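(* Let $(\mathfrak m,V,\omega,B_\mu)$ be a special symplectic representation over $k$. For all $P\in V$, the following identity holds in $\mathfrak{sp}(V,\omega)$: $$\tau(\Psi(P))-Q(P)\,\tau(P)=-\frac34\,\mu(P)^3+\frac1{12}\,Q(P)\,\mu(P),$$ where $\mu(P)\in\mathfrak m$ is identified with the endomorphism of $V$ by which it acts and $\mu(P)^3$ is the composition power of this endomorphism.
   Context: $k$ is a field of characteristic not $2$ or $3$; $V$ is finite-dimensional. A special symplectic representation (SSR) $(\mathfrak m,V,\omega,B_\mu)$ over $k$ is a faithful representation of a Lie algebra $\mathfrak m$ over $k$ on a symplectic vector space $(V,\omega)$ ($\omega$ a nondegenerate alternating bilinear form), together with an $\mathfrak m$-equivariant symmetric bilinear map $B_\mu:V\times V\to\mathfrak m$ (equivariance: $[m,B_\mu(A,B)]=B_\mu(m\cdot A,B)+B_\mu(A,m\cdot B)$), such that for all $m\in\mathfrak m$ and $A,B,C\in V$: $$\omega(m\cdot A,B)+\omega(A,m\cdot B)=0,$$ $$2B_\mu(A,B)\cdot C-2B_\mu(A,C)\cdot B=2\omega(B,C)A-\omega(A,B)C+\omega(A,C)B.$$ Covariants: $\mu(A)=B_\mu(A,A)\in\mathfrak m$, $\Psi(A)=\mu(A)\cdot A\in V$, $Q(A)=\frac32\,\omega(A,\Psi(A))\in k$. The map $\tau:V\to\mathfrak{sp}(V,\omega)$ is $\tau(v)(w)=\omega(v,w)v$. *)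

theory Defs
  imports Complex_Main
begin

definition bilinear_map ::
  "('k::field \<Rightarrow> 'a::ab_group_add \<Rightarrow> 'a) \<Rightarrow> ('k \<Rightarrow> 'b::ab_group_add \<Rightarrow> 'b) \<Rightarrow>
   ('k \<Rightarrow> 'c::ab_group_add \<Rightarrow> 'c) \<Rightarrow> ('a \<Rightarrow> 'b \<Rightarrow> 'c) \<Rightarrow> bool"
where
  "bilinear_map s1 s2 s3 f \<longleftrightarrow>
     (\<forall>y. Vector_Spaces.linear s1 s3 (\<lambda>x. f x y)) \<and> (\<forall>x. Vector_Spaces.linear s2 s3 (f x))"

locale lie_algebra = vector_space scale
  for scale :: "'k::field \<Rightarrow> 'm::ab_group_add \<Rightarrow> 'm" +
  fixes bracket :: "'m \<Rightarrow> 'm \<Rightarrow> 'm"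
  assumes bracket_bilinear: "bilinear_map scale scale scale bracket"
    and bracket_alternating: "bracket x x = 0"
    and jacobi: "bracket x (bracket y z) + bracket y (bracket z x) + bracket z (bracket x y) = 0"

locale symplectic_vector_space = vector_space scale
  for scale :: "'k::field \<Rightarrow> 'v::ab_group_add \<Rightarrow> 'v" +
  fixes \<omega> :: "'v \<Rightarrow> 'v \<Rightarrow> 'k"
  assumes finite_dimensional: "\<exists>Basis. finite_dimensional_vector_space scale Basis"
    \<comment> \<open>the ground field is a vector space over itself via multiplication\<close>
    and \<omega>_bilinear: "bilinear_map scale scale (*) \<omega>"
    and \<omega>_alternating: "\<omega> v v = 0"
    and \<omega>_nondegenerate: "(\<And>w. \<omega> v w = 0) \<Longrightarrow> v = 0"

locale faithful_lie_representation =
  lie_algebra scaleM bracket + V: vector_space scaleV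
  for scaleM :: "'k::field \<Rightarrow> 'm::ab_group_add \<Rightarrow> 'm"
    and bracket :: "'m \<Rightarrow> 'm \<Rightarrow> 'm"
    and scaleV :: "'k \<Rightarrow> 'v::ab_group_add \<Rightarrow> 'v" +
  fixes act :: "'m \<Rightarrow> 'v \<Rightarrow> 'v"
  assumes act_bilinear: "bilinear_map scaleM scaleV scaleV act"
    and act_bracket: "act (bracket x y) v = act x (act y v) - act y (act x v)"
    and act_faithful: "inj act"

locale special_symplectic_representation =
  faithful_lie_representation scaleM bracket scaleV act + symplectic_vector_space scaleV \<omega>
  for scaleM :: "'k::field \<Rightarrow> 'm::ab_group_add \<Rightarrow> 'm"
    and bracket :: "'m \<Rightarrow> 'm \<Rightarrow> 'm"
    and scaleV :: "'k \<Rightarrow> 'v::ab_group_add \<Rightarrow> 'v"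
    and act :: "'m \<Rightarrow> 'v \<Rightarrow> 'v"
    and \<omega> :: "'v \<Rightarrow> 'v \<Rightarrow> 'k" +
  fixes B :: "'v \<Rightarrow> 'v \<Rightarrow> 'm"
  assumes B_bilinear: "bilinear_map scaleV scaleV scaleM B"
    and B_symmetric: "B u v = B v u"
    and B_equivariant: "bracket m (B u v) = B (act m u) v + B u (act m v)"
    and \<omega>_invariant: "\<omega> (act m u) v + \<omega> u (act m v) = 0"
    and B_special:
      "scaleV 2 (act (B u v) w) - scaleV 2 (act (B u w) v) =
       scaleV (2 * \<omega> v w) u - scaleV (\<omega> u v) w + scaleV (\<omega> u w) v"

definition \<mu> :: "('v \<Rightarrow> 'v \<Rightarrow> 'm) \<Rightarrow> 'v \<Rightarrow> 'm" where
  "\<mu> B v = B v v"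

definition \<Psi> :: "('m \<Rightarrow> 'v \<Rightarrow> 'v) \<Rightarrow> ('v \<Rightarrow> 'v \<Rightarrow> 'm) \<Rightarrow> 'v \<Rightarrow> 'v" where
  "\<Psi> act B v = act (\<mu> B v) v"

definition Q ::
  "('m \<Rightarrow> 'v \<Rightarrow> 'v) \<Rightarrow> ('v \<Rightarrow> 'v \<Rightarrow> 'k::field) \<Rightarrow> ('v \<Rightarrow> 'v \<Rightarrow> 'm) \<Rightarrow> 'v \<Rightarrow> 'k" where
  "Q act \<omega> B v = 3 / 2 * \<omega> v (\<Psi> act B v)"

definition \<tau> :: "('k \<Rightarrow> 'v \<Rightarrow> 'v) \<Rightarrow> ('v \<Rightarrow> 'v \<Rightarrow> 'k) \<Rightarrow> 'v \<Rightarrow> 'v \<Rightarrow> 'v" where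
  "\<tau> scale \<omega> v w = scale (\<omega> v w) v"

definition sp ::
  "('k::field \<Rightarrow> 'v::ab_group_add \<Rightarrow> 'v) \<Rightarrow> ('v \<Rightarrow> 'v \<Rightarrow> 'k) \<Rightarrow> ('v \<Rightarrow> 'v) set" where
  "sp scale \<omega> =
     {f. Vector_Spaces.linear scale scale f \<and> (\<forall>u v. \<omega> (f u) v + \<omega> u (f v) = 0)}"

end

theory Submission
  imports Defs
begin

text \<open>
  Fix \<open>P\<close>, let \<open>m = \<mu>(P) = B(P, P)\<close> act on \<open>V\<close>, and put \<open>p = m P = \<Psi>(P)\<close>, \<open>Q = 3/2 \<omega>(P, p)\<close>.  The cubic
  identity comes from a quadratic one,
  \[ 3 m^2 w = 4 \omega(P, w) p + (Q/3) w - 4 \omega(p, w) P, \]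
  by applying \<open>m\<close> once more, using \<open>m P = p\<close> and \<open>m p = Q P\<close>, and multiplying by \<open>-1/4\<close>.

  The point is to express \<open>m\<^sup>2\<close> through rank-one terms and a scalar.  The special identity lets one
  exchange the last two arguments of \<open>(u, v, w) \<mapsto> B(u, v) w\<close> at the cost of terms in \<open>\<omega>\<close>; in
  particular \<open>m w\<close> and \<open>B(P, w) P\<close> differ only by a multiple of \<open>P\<close>.  Equivariance computes the bracket
  of \<open>m = B(P, P)\<close> with \<open>B(P, w)\<close> in two ways, letting either one act on the arguments of the other.
  Since the bracket is antisymmetric, the two results cancel, and this yields the relation
  \<open>3 B(P, m w) = 3 \<omega>(P, w) m - B(p, w)\<close> in the Lie algebra.  Letting both sides act on \<open>P\<close> and
  exchanging arguments again turns the left side into \<open>3 m\<^sup>2 w\<close>, up to a multiple of \<open>P\<close>, and the right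
  side into terms in \<open>P\<close>, \<open>p\<close> and \<open>w\<close>, because \<open>B(p, P) = 0\<close>.  Membership in \<open>sp(V, \<omega>)\<close> holds
  because every \<open>\<tau>(v)\<close> lies there.
\<close>

section \<open>Bilinearity\<close>

lemma bilinear_map_simps:
  assumes "bilinear_map s1 s2 s3 f"
  shows "f (x + x') y = f x y + f x' y" "f x (y + y') = f x y + f x y'"
    and "f (x - x') y = f x y - f x' y" "f x (y - y') = f x y - f x y'"
    and "f (s1 c x) y = s3 c (f x y)" "f x (s2 c y) = s3 c (f x y)"
    and "f 0 y = 0" "f x 0 = 0"
    and "f (- x) y = - f x y" "f x (- y) = - f x y"
proof -
  interpret L: Vector_Spaces.linear s1 s3 "\<lambda>x. f x y" for y
    using assms by (simp add: bilinear_map_def)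
  interpret R: Vector_Spaces.linear s2 s3 "f x" for x
    using assms by (simp add: bilinear_map_def)
  show "f (x + x') y = f x y + f x' y" "f x (y + y') = f x y + f x y'"
    "f (x - x') y = f x y - f x' y" "f x (y - y') = f x y - f x y'"
    "f (s1 c x) y = s3 c (f x y)" "f x (s2 c y) = s3 c (f x y)"
    "f 0 y = 0" "f x 0 = 0"
    "f (- x) y = - f x y" "f x (- y) = - f x y"
    by (fact L.add R.add L.diff R.diff L.scale R.scale L.zero R.zero L.neg R.neg)+
qed

section \<open>Small numerals in a field\<close>

lemma two_nonzero:
  assumes "CHAR('k::field) \<noteq> 2"
  shows "(2::'k) \<noteq> 0"
proof
  assume "(2::'k) = 0"
  then have d: "CHAR('k) dvd 2"
    using of_nat_eq_0_iff_char_dvd[where 'a = 'k, of 2] by simp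
  then have "CHAR('k) \<le> 2" by (simp add: dvd_imp_le)
  moreover have "CHAR('k) \<noteq> 1" by simp
  ultimately have "CHAR('k) = 0" using assms by linarith
  then show False using d by simp
qed

lemma three_nonzero:
  assumes "CHAR('k::field) \<noteq> 3"
  shows "(3::'k) \<noteq> 0"
proof
  assume "(3::'k) = 0"
  then have d: "CHAR('k) dvd 3"
    using of_nat_eq_0_iff_char_dvd[where 'a = 'k, of 3] by simp
  then have "CHAR('k) \<le> 3" by (simp add: dvd_imp_le)
  moreover have "CHAR('k) \<noteq> 1" by simp
  moreover have "CHAR('k) \<noteq> 2" using d by auto
  ultimately have "CHAR('k) = 0" using assms by linarith
  then show False using d by simp
qed

text \<open>
  Cancelling numerals in fractions is sound only when they are invertible, which in positive
  characteristic is an extra hypothesis.  Naming the inverse \<open>h\<close> makes an identity with denominators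
  polynomial, with the hypothesis recorded as the relation \<open>c h = 1\<close>.
\<close>

lemma division_as_multiplication:
  assumes "(c::'k::field) \<noteq> 0"
  obtains h where "c * h = 1" "\<And>x. x / c = h * x"
proof (rule that)
  show "c * (1 / c) = 1" using assms by simp
  show "x / c = 1 / c * x" for x by simp
qed

section \<open>Symplectic vector spaces\<close>

context symplectic_vector_space
begin

lemmas form_simps = bilinear_map_simps[OF \<omega>_bilinear]

lemma form_antisym: "\<omega> u v = - \<omega> v u"
proof -
  have "\<omega> u v + \<omega> v u = \<omega> (u + v) (u + v)"
    unfolding form_simps by (simp add: \<omega>_alternating)
  then have "\<omega> u v + \<omega> v u = 0" by (simp only: \<omega>_alternating)
  then show ?thesis by (rule eq_neg_iff_add_eq_0[THEN iffD2])
qed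

text \<open>
  Nondegeneracy reduces an equation between vectors to one between scalars, where commutative
  ring reasoning applies.
\<close>

lemma vector_eqI:
  assumes "\<And>z. \<omega> z a = \<omega> z b"
  shows "a = b"
proof -
  have "\<omega> (a - b) z = 0" for z
    using assms[of z] form_antisym[of a z] form_antisym[of b z] by (simp only: form_simps diff_self)
  then have "a - b = 0" by (rule \<omega>_nondegenerate)
  then show ?thesis by simp
qed

lemma \<tau>_in_sp: "\<tau> scale \<omega> v \<in> sp scale \<omega>"
proof -
  have "Vector_Spaces.linear scale scale (\<tau> scale \<omega> v)"
    by unfold_locales (simp_all add: \<tau>_def form_simps scale_left_distrib)
  moreover have "\<omega> (\<tau> scale \<omega> v u) w + \<omega> u (\<tau> scale \<omega> v w) = 0" for u w
    using form_antisym[of u v] by (simp add: \<tau>_def form_simps)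
  ultimately show ?thesis by (simp add: sp_def)
qed

lemma sp_diff_scale:
  assumes f: "f \<in> sp scale \<omega>" and g: "g \<in> sp scale \<omega>"
  shows "(\<lambda>w. f w - scale c (g w)) \<in> sp scale \<omega>"
proof -
  interpret f: Vector_Spaces.linear scale scale f using f by (simp add: sp_def)
  interpret g: Vector_Spaces.linear scale scale g using g by (simp add: sp_def)
  have "Vector_Spaces.linear scale scale (\<lambda>w. f w - scale c (g w))"
    by unfold_locales
      (simp_all add: f.add g.add f.scale g.scale scale_right_distrib scale_right_diff_distrib
        scale_left_commute)
  moreover have "\<omega> (f u - scale c (g u)) w + \<omega> u (f w - scale c (g w)) = 0" for u w
  proof -
    have "\<omega> (f u) w + \<omega> u (f w) = 0" "\<omega> (g u) w + \<omega> u (g w) = 0"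
      using f g by (simp_all add: sp_def)
    then show ?thesis unfolding form_simps by algebra
  qed
  ultimately show ?thesis by (simp add: sp_def)
qed

end

section \<open>Identities between the covariants\<close>

context special_symplectic_representation
begin

lemmas act_simps = bilinear_map_simps[OF act_bilinear]
lemmas B_simps = bilinear_map_simps[OF B_bilinear]
lemmas bracket_simps = bilinear_map_simps[OF bracket_bilinear]

lemma bracket_antisym: "bracket x y = - bracket y x"
proof -
  have "bracket x y + bracket y x = bracket (x + y) (x + y)"
    unfolding bracket_simps by (simp add: bracket_alternating)
  then have "bracket x y + bracket y x = 0" by (simp only: bracket_alternating)
  then show ?thesis by (rule eq_neg_iff_add_eq_0[THEN iffD2])
qed

lemma form_act_swap: "\<omega> u (act m v) = - \<omega> (act m u) v"
  using \<omega>_invariant[of m u v] by (simp only: eq_neg_iff_add_eq_0 add.commute)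

text \<open>
  The special identity measures the failure of \<open>B(u, v) w\<close> to be symmetric in all three arguments.
\<close>

lemma act_B_swap:
  assumes "(2::'k) \<noteq> 0"
  shows "act (B u v) w = act (B u w) v + scaleV (\<omega> v w) u
           - scaleV (\<omega> u v / 2) w + scaleV (\<omega> u w / 2) v"
proof (rule vector_eqI)
  fix z
  have special: "\<omega> z (scaleV 2 (act (B u v) w) - scaleV 2 (act (B u w) v)) =
        \<omega> z (scaleV (2 * \<omega> v w) u - scaleV (\<omega> u v) w + scaleV (\<omega> u w) v)"
    by (simp only: B_special)
  obtain h where h: "2 * h = (1::'k)" and half: "\<And>x::'k. x / 2 = h * x"
    using division_as_multiplication[OF assms] by blast
  have "2 * \<omega> z (act (B u v) w) = 2 * \<omega> z (act (B u w) v + scaleV (\<omega> v w) u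
           - scaleV (\<omega> u v / 2) w + scaleV (\<omega> u w / 2) v)"
    using special h unfolding form_simps half by algebra
  then show "\<omega> z (act (B u v) w) = \<omega> z (act (B u w) v + scaleV (\<omega> v w) u
           - scaleV (\<omega> u v / 2) w + scaleV (\<omega> u w / 2) v)"
    by (rule mult_left_cancel[OF assms, THEN iffD1])
qed

lemma act_B_same:
  assumes "(2::'k) \<noteq> 0"
  shows "act (B u w) u = act (B u u) w - scaleV (3 / 2 * \<omega> u w) u"
proof (rule vector_eqI)
  fix z
  obtain h where h: "2 * h = (1::'k)" and half: "\<And>x::'k. x / 2 = h * x"
    using division_as_multiplication[OF assms] by blast
  show "\<omega> z (act (B u w) u) = \<omega> z (act (B u u) w - scaleV (3 / 2 * \<omega> u w) u)"
    unfolding act_B_swap[OF assms, of u w u] form_simps half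
    using h form_antisym[of w u] \<omega>_alternating[of u] by algebra
qed

text \<open>\<open>\<mu>(P)\<close> commutes with itself, and by equivariance \<open>[\<mu>(P), \<mu>(P)] = 2 B(\<Psi>(P), P)\<close>.\<close>

lemma B_\<Psi>_self:
  assumes two: "(2::'k) \<noteq> 0"
  shows "B (\<Psi> act B P) P = 0"
proof -
  let ?x = "B (\<Psi> act B P) P"
  have "?x + B P (\<Psi> act B P) = 0"
    using B_equivariant[of "B P P" P P] by (simp add: bracket_alternating \<Psi>_def \<mu>_def)
  then have "scaleM 2 ?x = 0"
    using scale_left_distrib[of 1 1 ?x] B_symmetric[of P "\<Psi> act B P"] by simp
  then show ?thesis using two by simp
qed

text \<open>
  Exchanging arguments in \<open>B(P, P) \<Psi>(P)\<close> gives \<open>B(P, \<Psi>(P)) P = 0\<close>, up to a multiple of \<open>P\<close>.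
\<close>

lemma act_\<mu>_\<Psi>:
  assumes two: "(2::'k) \<noteq> 0"
  shows "act (\<mu> B P) (\<Psi> act B P) = scaleV (Q act \<omega> B P) P"
  using act_B_same[OF two, of P "\<Psi> act B P"] B_\<Psi>_self[OF two, of P]
    B_symmetric[of P "\<Psi> act B P"]
  by (simp add: act_simps Q_def \<mu>_def)

text \<open>
  The bracket of \<open>\<mu>(P)\<close> and \<open>B(P, w)\<close> is evaluated twice: once with \<open>\<mu>(P)\<close> acting on the arguments of
  \<open>B(P, w)\<close>, once with \<open>B(P, w)\<close> acting on those of \<open>\<mu>(P) = B(P, P)\<close>.  The second gives
  \<open>2 B(B(P, w) P, P)\<close>, which contains a further \<open>2 B(P, \<mu>(P) w)\<close>.
\<close>

lemma B_act_\<mu>: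
  assumes two: "(2::'k) \<noteq> 0"
  shows "scaleM 3 (B P (act (\<mu> B P) w)) = scaleM (3 * \<omega> P w) (\<mu> B P) - B (\<Psi> act B P) w"
proof -
  let ?m = "\<mu> B P" and ?p = "\<Psi> act B P"
  let ?x = "B P (act ?m w)" and ?y = "act (B P w) P"
  let ?s = "scaleM (3 / 2 * \<omega> P w) ?m"
  have swap: "B ?y P = ?x - ?s"
    using B_symmetric[of ?y P]
    by (simp add: act_B_same[OF two] B_simps \<mu>_def)
  have "bracket ?m (B P w) = B ?p w + ?x"
    by (simp add: B_equivariant \<Psi>_def)
  moreover have "bracket (B P w) ?m = B ?y P + B ?y P"
    using B_symmetric[of P ?y] by (simp add: \<mu>_def B_equivariant)
  \<comment> \<open>antisymmetry of the bracket: the two values add up to zero\<close>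
  ultimately have "B ?p w + ?x + (B ?y P + B ?y P) = 0"
    using bracket_antisym[of ?m "B P w"] by (metis eq_neg_iff_add_eq_0)
  then have "?x + ?x + ?x = (?s + ?s) - B ?p w"
    unfolding swap by (simp add: algebra_simps)
  moreover have "?s + ?s = scaleM (3 * \<omega> P w) ?m"
  proof -
    obtain h where h: "2 * h = (1::'k)" and half: "\<And>x::'k. x / 2 = h * x"
      using division_as_multiplication[OF two] by blast
    have "3 / 2 * \<omega> P w + 3 / 2 * \<omega> P w = 3 * \<omega> P w"
      using h unfolding half by algebra
    then show ?thesis by (simp only: scale_left_distrib[symmetric])
  qed
  moreover have "scaleM 3 ?x = ?x + ?x + ?x"
    using scale_left_distrib[of 1 1 ?x] scale_left_distrib[of 2 1 ?x] by simp
  ultimately show ?thesis by simp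
qed

text \<open>
  Both sides of the preceding relation are applied to \<open>P\<close>.  On the left, \<open>B(P, \<mu>(P) w) P\<close> is
  \<open>\<mu>(P)\<^sup>2 w\<close> up to a multiple of \<open>P\<close>; on the right, \<open>B(\<Psi>(P), w) P\<close> is \<open>B(\<Psi>(P), P) w = 0\<close> up to
  terms in \<open>\<omega>\<close>.
\<close>

lemma act_\<mu>_squared:
  assumes two: "(2::'k) \<noteq> 0" and three: "(3::'k) \<noteq> 0"
  shows "scaleV 3 (act (\<mu> B P) (act (\<mu> B P) w)) =
    scaleV (4 * \<omega> P w) (\<Psi> act B P) + scaleV (Q act \<omega> B P / 3) w
      - scaleV (4 * \<omega> (\<Psi> act B P) w) P"
proof (rule vector_eqI)
  fix z
  let ?m = "\<mu> B P" and ?p = "\<Psi> act B P"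
  have "act (scaleM 3 (B P (act ?m w))) P = act (scaleM (3 * \<omega> P w) ?m - B ?p w) P"
    by (simp only: B_act_\<mu>[OF two])
  then have "\<omega> z (scaleV 3 (act (B P (act ?m w)) P)) = \<omega> z (scaleV (3 * \<omega> P w) ?p - act (B ?p w) P)"
    by (simp only: act_simps \<Psi>_def)
  then have rel: "3 * \<omega> z (act (B P (act ?m w)) P)
      = 3 * \<omega> P w * \<omega> z ?p - \<omega> z (act (B ?p w) P)"
    by (simp only: form_simps)
  have "act (B P (act ?m w)) P = act ?m (act ?m w) - scaleV (3 / 2 * \<omega> P (act ?m w)) P"
    unfolding \<mu>_def by (rule act_B_same[OF two])
  moreover have "\<omega> P (act ?m w) = - \<omega> ?p w"
    unfolding \<Psi>_def by (rule form_act_swap)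
  ultimately have left: "\<omega> z (act (B P (act ?m w)) P)
      = \<omega> z (act ?m (act ?m w)) + 3 / 2 * \<omega> ?p w * \<omega> z P"
    by (simp add: form_simps)
  have right: "\<omega> z (act (B ?p w) P)
      = - \<omega> P w * \<omega> z ?p - \<omega> P ?p / 2 * \<omega> z w - \<omega> ?p w / 2 * \<omega> z P"
    using form_antisym[of w P] form_antisym[of ?p P]
    by (simp add: act_B_swap[OF two, of ?p w P] B_\<Psi>_self[OF two] act_simps form_simps)
  obtain h where h: "2 * h = (1::'k)" and half: "\<And>x::'k. x / 2 = h * x"
    using division_as_multiplication[OF two] by blast
  obtain t where t: "3 * t = (1::'k)" and third: "\<And>x::'k. x / 3 = t * x"
    using division_as_multiplication[OF three] by blast
  show "\<omega> z (scaleV 3 (act ?m (act ?m w))) =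
    \<omega> z (scaleV (4 * \<omega> P w) ?p + scaleV (Q act \<omega> B P / 3) w - scaleV (4 * \<omega> ?p w) P)"
    using rel h t unfolding left right form_simps Q_def half third by algebra
qed

end

section \<open>The cubic identity\<close>

theorem theorem4p16:
  fixes scaleM :: "'k::field \<Rightarrow> 'm::ab_group_add \<Rightarrow> 'm"
    and bracket :: "'m \<Rightarrow> 'm \<Rightarrow> 'm"
    and scaleV :: "'k \<Rightarrow> 'v::ab_group_add \<Rightarrow> 'v"
    and act :: "'m \<Rightarrow> 'v \<Rightarrow> 'v"
    and \<omega> :: "'v \<Rightarrow> 'v \<Rightarrow> 'k"
    and B :: "'v \<Rightarrow> 'v \<Rightarrow> 'm"
    and P :: 'v
  assumes "CHAR('k) \<noteq> 2" and "CHAR('k) \<noteq> 3"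
    and "special_symplectic_representation scaleM bracket scaleV act \<omega> B"
  shows "(\<lambda>w. \<tau> scaleV \<omega> (\<Psi> act B P) w - scaleV (Q act \<omega> B P) (\<tau> scaleV \<omega> P w)) \<in> sp scaleV \<omega> \<and>
    (\<lambda>w. \<tau> scaleV \<omega> (\<Psi> act B P) w - scaleV (Q act \<omega> B P) (\<tau> scaleV \<omega> P w)) =
    (\<lambda>w. scaleV (- (3 / 4)) ((act (\<mu> B P) ^^ 3) w)
         + scaleV (1 / 12 * Q act \<omega> B P) (act (\<mu> B P) w))"
proof (intro conjI ext)
  interpret special_symplectic_representation scaleM bracket scaleV act \<omega> B by fact
  have two: "(2::'k) \<noteq> 0" and three: "(3::'k) \<noteq> 0"
    using two_nonzero three_nonzero assms(1,2) by blast+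
  show "(\<lambda>w. \<tau> scaleV \<omega> (\<Psi> act B P) w - scaleV (Q act \<omega> B P) (\<tau> scaleV \<omega> P w)) \<in> sp scaleV \<omega>"
    by (intro sp_diff_scale \<tau>_in_sp)
  fix w
  let ?m = "\<mu> B P" and ?p = "\<Psi> act B P" and ?q = "Q act \<omega> B P"
  show "\<tau> scaleV \<omega> ?p w - scaleV ?q (\<tau> scaleV \<omega> P w) =
    scaleV (- (3 / 4)) ((act ?m ^^ 3) w) + scaleV (1 / 12 * ?q) (act ?m w)"
  proof (rule vector_eqI)
    fix z
    have "act ?m (scaleV 3 (act ?m (act ?m w))) =
        act ?m (scaleV (4 * \<omega> P w) ?p + scaleV (?q / 3) w - scaleV (4 * \<omega> ?p w) P)"
      by (simp only: act_\<mu>_squared[OF two three])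
    then have "\<omega> z (scaleV 3 (act ?m (act ?m (act ?m w)))) =
        \<omega> z (scaleV (4 * \<omega> P w) (scaleV ?q P) + scaleV (?q / 3) (act ?m w)
          - scaleV (4 * \<omega> ?p w) ?p)"
      by (simp only: act_simps act_\<mu>_\<Psi>[OF two] \<Psi>_def[symmetric])
    then have cube: "3 * \<omega> z (act ?m (act ?m (act ?m w))) =
        4 * \<omega> P w * (?q * \<omega> z P) + ?q / 3 * \<omega> z (act ?m w) - 4 * \<omega> ?p w * \<omega> z ?p"
      by (simp only: form_simps)
    have "(4::'k) \<noteq> 0" and "(12::'k) \<noteq> 0"
    proof -
      have "(4::'k) = 2 * 2" "(12::'k) = 2 * 2 * 3" by simp_all
      then show "(4::'k) \<noteq> 0" "(12::'k) \<noteq> 0" using two three by (metis mult_eq_0_iff)+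
    qed
    obtain t where t: "3 * t = (1::'k)" and third: "\<And>x::'k. x / 3 = t * x"
      using division_as_multiplication[OF three] by blast
    obtain a where a: "4 * a = (1::'k)" and quarter: "\<And>x::'k. x / 4 = a * x"
      using division_as_multiplication[OF \<open>4 \<noteq> 0\<close>] by blast
    obtain b where b: "12 * b = (1::'k)" and twelfth: "\<And>x::'k. x / 12 = b * x"
      using division_as_multiplication[OF \<open>12 \<noteq> 0\<close>] by blast
    \<comment> \<open>the inverse of 12 is the product of the inverses of 4 and 3\<close>
    have "b * (4 * a * (3 * t)) = a * t * (12 * b)"
      by algebra
    then have ta: "b = a * t"
      by (simp only: t a b mult_1_right)
    have cube': "a * (3 * \<omega> z (act ?m (act ?m (act ?m w)))) =
        a * (4 * \<omega> P w * (?q * \<omega> z P) + t * ?q * \<omega> z (act ?m w) - 4 * \<omega> ?p w * \<omega> z ?p)"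
      by (simp only: cube third)
    have power3: "(act ?m ^^ 3) w = act ?m (act ?m (act ?m w))"
      by (simp add: numeral_3_eq_3)
    show "\<omega> z (\<tau> scaleV \<omega> ?p w - scaleV ?q (\<tau> scaleV \<omega> P w)) =
      \<omega> z (scaleV (- (3 / 4)) ((act ?m ^^ 3) w) + scaleV (1 / 12 * ?q) (act ?m w))"
      using cube' a ta unfolding power3 \<tau>_def form_simps third quarter twelfth by algebra
  qed
qed

end
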